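(* Let $\nu\ge0$, $\sigma\in\mathbb R$, and let $(u,q,V)$ be a smooth real-valued solution on $\mathbb R\times[0,T)$ of $$u_t+Vu_x=2qu+\nu u_{xx},\qquad q_t+Vq_x=q^2-\sigma u^2+\nu q_{xx},\qquad V_x=2q,\quad V(0,t)=0.$$ (i) If $\sigma=c^2>0$ with $c\in\mathbb R$, and $Z=q+icu$, then $$Z_t+VZ_x=Z^2+\nu Z_{xx},\qquad V_x=2\operatorname{Re}Z.$$ (ii) If $\sigma=-c^2<0$ with $c\in\mathbb R$, and $a_+=q+cu$, $a_-=q-cu$, then $$(a_\pm)_t+V(a_\pm)_x=a_\pm^2+\nu(a_\pm)_{xx},\qquad V_x=a_++a_-.$$
   Context: Subscripts $t,x$ denote partial derivatives; $i$ is the imaginary unit. *)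

theory Defs
  imports "HOL-Analysis.Analysis"
begin

text \<open>
  Functions on \<open>\<real> \<times> [0,T)\<close> are curried, space variable first: \<open>f x t\<close>.
  The horizon \<open>T\<close> is an extended real, so that \<open>T = \<infinity>\<close> is allowed.
\<close>

definition time_dom :: "ereal \<Rightarrow> real set" where
  "time_dom T = {t. 0 \<le> t \<and> ereal t < T}"

definition d_x :: "(real \<Rightarrow> real \<Rightarrow> 'a::real_normed_vector) \<Rightarrow> real \<Rightarrow> real \<Rightarrow> 'a" where
  "d_x f x t = vector_derivative (\<lambda>y. f y t) (at x)"

text \<open>
  The time derivative is taken within \<open>[0,T)\<close>: it is the ordinary derivative for \<open>0 < t < T\<close>
  and the right derivative at \<open>t = 0\<close>.
\<close>

definition d_t :: "ereal \<Rightarrow> (real \<Rightarrow> real \<Rightarrow> 'a::real_normed_vector) \<Rightarrow> real \<Rightarrow> real \<Rightarrow> 'a" where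
  "d_t T f x t = vector_derivative (\<lambda>s. f x s) (at t within time_dom T)"

text \<open>
  \<open>C\<^sup>k\<close> up to the boundary \<open>t = 0\<close>: all mixed partial derivatives of order at most \<open>k\<close>, taken in any
  order, exist and are jointly continuous on \<open>\<real> \<times> [0,T)\<close>. Existence is demanded explicitly because
  \<^const>\<open>vector_derivative\<close> is total. Only the values of \<open>f\<close> on \<open>\<real> \<times> [0,T)\<close> matter.
\<close>

primrec Ck_strip :: "ereal \<Rightarrow> nat \<Rightarrow> (real \<Rightarrow> real \<Rightarrow> 'a::real_normed_vector) \<Rightarrow> bool" where
  "Ck_strip T 0 f \<longleftrightarrow> continuous_on (UNIV \<times> time_dom T) (\<lambda>(x, t). f x t)"
| "Ck_strip T (Suc k) f \<longleftrightarrow>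
     continuous_on (UNIV \<times> time_dom T) (\<lambda>(x, t). f x t) \<and>
     (\<forall>x. \<forall>t\<in>time_dom T. (\<lambda>y. f y t) differentiable (at x) \<and>
                      (\<lambda>s. f x s) differentiable (at t within time_dom T)) \<and>
     Ck_strip T k (d_x f) \<and> Ck_strip T k (d_t T f)"

definition smooth_strip :: "ereal \<Rightarrow> (real \<Rightarrow> real \<Rightarrow> 'a::real_normed_vector) \<Rightarrow> bool" where
  "smooth_strip T f \<longleftrightarrow> (\<forall>k. Ck_strip T k f)"

end

theory Submission
  imports Defs
begin

text \<open>
  With \<open>k\<^sup>2 = -\<sigma>\<close>, where \<open>k\<close> may lie in an extension of the reals, put \<open>w = q + k u\<close>. The transport
  operator \<open>\<partial>\<^sub>t + V \<partial>\<^sub>x\<close> and the diffusion operator \<open>\<nu> \<partial>\<^sub>x\<^sub>x\<close> are linear over constants, so adding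
  \<open>k\<close> times the equation for \<open>u\<close> to the equation for \<open>q\<close> gives the reaction term
  \<open>q\<^sup>2 - \<sigma> u\<^sup>2 + 2 k q u = (q + k u)\<^sup>2 = w\<^sup>2\<close>. The choices \<open>k = \<i> c\<close> and \<open>k = \<plusminus> c\<close> are parts (i) and (ii),
  and \<open>V\<^sub>x = 2 q\<close> is rewritten with \<open>q = Re Z\<close> and \<open>2 q = a\<^sub>+ + a\<^sub>-\<close> respectively.

  The analytic content is that the derivatives \<^const>\<open>d_x\<close> and \<^const>\<open>d_t\<close> commute with
  bounded linear maps on the strip (lemmas \<open>d_x_linear_combination\<close> and \<open>d_t_linear_combination\<close>),
  whence smoothness is inherited by \<open>w\<close> (\<open>smooth_strip_linear_combination\<close>). Both cases
  are then instances of \<open>reaction_square\<close>, in which \<open>k\<close> lives in a real normed field.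
\<close>

text \<open>
  A nonempty half-open interval \<open>[0,T)\<close> has no isolated points, so derivatives within it are unique.
\<close>
lemma at_within_time_dom_neq_bot:
  assumes "t \<in> time_dom T"
  shows "at t within time_dom T \<noteq> bot"
proof -
  from assms have t: "0 \<le> t" "ereal t < T" by (auto simp: time_dom_def)
  obtain s where s: "ereal t < ereal s" "ereal s < T"
    using ereal_dense2[OF t(2)] by blast
  have "{t<..<s} \<subseteq> time_dom T"
  proof
    fix r assume "r \<in> {t<..<s}"
    then have "0 \<le> r" "ereal r < ereal s" using t(1) by auto
    then show "r \<in> time_dom T" using less_trans[OF _ s(2)] by (simp add: time_dom_def)
  qed
  moreover have "t islimpt {t<..<s}" using s(1) by (simp add: islimpt_greaterThanLessThan1)
  ultimately have "t islimpt time_dom T" by (rule islimpt_subset[rotated])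
  then show ?thesis by (simp add: trivial_limit_within)
qed

text \<open>
  In this and the next two lemmas \<open>h\<close> is identified with the combination only at the times that the
  derivatives in question see. At times outside \<open>[0,T)\<close> the total operators \<^const>\<open>d_x\<close> and \<^const>\<open>d_t\<close> take arbitrary values, so a derivative of a
  combination is the combination of the derivatives on the strip but not as a function; this weaker
  hypothesis is the one that survives repeated differentiation.
\<close>
lemma d_x_linear_combination:
  assumes "bounded_linear F" "bounded_linear G"
    and h: "\<And>x. h x t = F (f x t) + G (g x t)"
    and f: "(\<lambda>y. f y t) differentiable (at x)" and g: "(\<lambda>y. g y t) differentiable (at x)"
  shows "d_x h x t = F (d_x f x t) + G (d_x g x t)"
    and "(\<lambda>y. h y t) differentiable (at x)"
proof -
  have "((\<lambda>y. F (f y t) + G (g y t)) has_vector_derivative F (d_x f x t) + G (d_x g x t)) (at x)"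
    unfolding d_x_def
    by (rule has_vector_derivative_add[
          OF bounded_linear.has_vector_derivative[OF assms(1) f[unfolded vector_derivative_works]]
            bounded_linear.has_vector_derivative[OF assms(2) g[unfolded vector_derivative_works]]])
  then have *: "((\<lambda>y. h y t) has_vector_derivative F (d_x f x t) + G (d_x g x t)) (at x)"
    by (simp add: h)
  then show "d_x h x t = F (d_x f x t) + G (d_x g x t)"
    unfolding d_x_def[of h] by (rule vector_derivative_at)
  show "(\<lambda>y. h y t) differentiable (at x)" using * by (rule differentiableI_vector)
qed

lemma d_t_linear_combination:
  assumes "bounded_linear F" "bounded_linear G"
    and h: "\<And>s. s \<in> time_dom T \<Longrightarrow> h x s = F (f x s) + G (g x s)"
    and t: "t \<in> time_dom T"
    and f: "(\<lambda>s. f x s) differentiable (at t within time_dom T)"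
    and g: "(\<lambda>s. g x s) differentiable (at t within time_dom T)"
  shows "d_t T h x t = F (d_t T f x t) + G (d_t T g x t)"
    and "(\<lambda>s. h x s) differentiable (at t within time_dom T)"
proof -
  have "((\<lambda>s. F (f x s) + G (g x s)) has_vector_derivative F (d_t T f x t) + G (d_t T g x t))
      (at t within time_dom T)"
    unfolding d_t_def
    by (rule has_vector_derivative_add[
          OF bounded_linear.has_vector_derivative[OF assms(1) f[unfolded vector_derivative_works]]
            bounded_linear.has_vector_derivative[OF assms(2) g[unfolded vector_derivative_works]]])
  then have *: "((\<lambda>s. h x s) has_vector_derivative F (d_t T f x t) + G (d_t T g x t))
      (at t within time_dom T)"
    by (rule has_vector_derivative_transform[OF t, rotated]) (rule h)
  show "d_t T h x t = F (d_t T f x t) + G (d_t T g x t)"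
    unfolding d_t_def[of T h]
    by (rule vector_derivative_within[OF at_within_time_dom_neq_bot[OF t] *])
  show "(\<lambda>s. h x s) differentiable (at t within time_dom T)" using * by (rule differentiableI_vector)
qed

lemma Ck_strip_linear_combination:
  assumes "bounded_linear F" "bounded_linear G"
    and "Ck_strip T k f" "Ck_strip T k g"
    and "\<And>x t. t \<in> time_dom T \<Longrightarrow> h x t = F (f x t) + G (g x t)"
  shows "Ck_strip T k h"
  using assms(3-)
proof (induction k arbitrary: f g h)
  case (0 f g h)
  have "continuous_on (UNIV \<times> time_dom T) (\<lambda>p. F ((\<lambda>(x, t). f x t) p) + G ((\<lambda>(x, t). g x t) p))"
    using 0(1,2)
    by (auto intro!: continuous_on_add bounded_linear.continuous_on[OF assms(1)]
        bounded_linear.continuous_on[OF assms(2)])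
  then show ?case
    by (simp only: Ck_strip.simps) (rule continuous_on_eq, assumption, auto simp: 0(3))
next
  case (Suc k f g h)
  have "continuous_on (UNIV \<times> time_dom T) (\<lambda>p. F ((\<lambda>(x, t). f x t) p) + G ((\<lambda>(x, t). g x t) p))"
    using Suc.prems(1,2)
    by (auto intro!: continuous_on_add bounded_linear.continuous_on[OF assms(1)]
        bounded_linear.continuous_on[OF assms(2)])
  then have cont: "continuous_on (UNIV \<times> time_dom T) (\<lambda>(x, t). h x t)"
    by (rule continuous_on_eq) (auto simp: Suc.prems(3))
  have df: "(\<lambda>y. f y t) differentiable (at x)" "(\<lambda>y. g y t) differentiable (at x)"
      "(\<lambda>s. f x s) differentiable (at t within time_dom T)"
      "(\<lambda>s. g x s) differentiable (at t within time_dom T)" if "t \<in> time_dom T" for x t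
    using Suc.prems(1,2) that by simp_all
  note dx = d_x_linear_combination[of F G h _ f g, OF assms(1,2) Suc.prems(3) df(1,2)]
  note dt = d_t_linear_combination[of F G T h _ f g, OF assms(1,2) Suc.prems(3) _ df(3,4)]
  have "Ck_strip T k (d_x h)"
    by (rule Suc.IH[of "d_x f" "d_x g"]) (use Suc.prems(1,2) in simp, use Suc.prems(1,2) in simp,
        simp add: dx(1))
  moreover have "Ck_strip T k (d_t T h)"
    by (rule Suc.IH[of "d_t T f" "d_t T g"]) (use Suc.prems(1,2) in simp, use Suc.prems(1,2) in simp,
        simp add: dt(1))
  ultimately show ?case by (simp add: cont dx(2) dt(2))
qed

lemma smooth_strip_linear_combination:
  assumes "bounded_linear F" "bounded_linear G" "smooth_strip T f" "smooth_strip T g"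
  shows "smooth_strip T (\<lambda>x t. F (f x t) + G (g x t))"
  using assms unfolding smooth_strip_def by (blast intro: Ck_strip_linear_combination)

lemma smooth_strip_of_real_add_mult:
  fixes k :: "'a::real_normed_field" and f g :: "real \<Rightarrow> real \<Rightarrow> real"
  assumes "smooth_strip T f" "smooth_strip T g"
  shows "smooth_strip T (\<lambda>x t. of_real (f x t) + k * of_real (g x t))"
  by (rule smooth_strip_linear_combination[OF bounded_linear_of_real
        bounded_linear_const_mult[OF bounded_linear_of_real] assms])

lemma smooth_strip_differentiable:
  assumes "smooth_strip T f" "t \<in> time_dom T"
  shows "(\<lambda>y. f y t) differentiable (at x)" "(\<lambda>s. f x s) differentiable (at t within time_dom T)"
proof -
  have "Ck_strip T (Suc 0) f" using assms(1) unfolding smooth_strip_def by blast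
  then show "(\<lambda>y. f y t) differentiable (at x)"
      "(\<lambda>s. f x s) differentiable (at t within time_dom T)"
    using assms(2) by simp_all
qed

lemma smooth_strip_d_x:
  assumes "smooth_strip T f"
  shows "smooth_strip T (d_x f)"
  unfolding smooth_strip_def
proof
  fix k
  have "Ck_strip T (Suc k) f" using assms unfolding smooth_strip_def by blast
  then show "Ck_strip T k (d_x f)" by simp
qed

text \<open>
  Completing the square: \<open>k\<close> is a square root of \<open>-\<sigma>\<close>, so that \<open>-\<sigma> u\<^sup>2\<close> and the coupling term
  \<open>2 k q u\<close> are exactly what turns \<open>q\<^sup>2\<close> into \<open>(q + k u)\<^sup>2\<close>. A general real normed field admits both
  imaginary and real \<open>k\<close>.
\<close>
lemma reaction_square:
  fixes k :: "'a::real_normed_field" and u q V :: "real \<Rightarrow> real \<Rightarrow> real"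
  assumes u: "smooth_strip T u" and q: "smooth_strip T q"
    and t: "t \<in> time_dom T"
    and equ: "d_t T u x t + V x t * d_x u x t = 2 * q x t * u x t + \<nu> * d_x (d_x u) x t"
    and eqq: "d_t T q x t + V x t * d_x q x t
      = (q x t)\<^sup>2 - \<sigma> * (u x t)\<^sup>2 + \<nu> * d_x (d_x q) x t"
    and k: "k\<^sup>2 = - of_real \<sigma>"
  defines "w \<equiv> \<lambda>x t. of_real (q x t) + k * of_real (u x t)"
  shows "d_t T w x t + of_real (V x t) * d_x w x t = (w x t)\<^sup>2 + of_real \<nu> * d_x (d_x w) x t"
proof -
  have lin: "bounded_linear (of_real :: real \<Rightarrow> 'a)" "bounded_linear (\<lambda>r. k * of_real r)"
    by (rule bounded_linear_of_real, rule bounded_linear_const_mult[OF bounded_linear_of_real])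
  have wx: "d_x w y t = of_real (d_x q y t) + k * of_real (d_x u y t)" for y
    by (rule d_x_linear_combination(1)[OF lin])
      (simp_all add: w_def smooth_strip_differentiable(1)[OF _ t] u q)
  have wxx: "d_x (d_x w) x t = of_real (d_x (d_x q) x t) + k * of_real (d_x (d_x u) x t)"
    by (rule d_x_linear_combination(1)[where h = "d_x w" and f = "d_x q" and g = "d_x u", OF lin wx])
      (simp_all add: smooth_strip_differentiable(1)[OF _ t] smooth_strip_d_x u q)
  have wt: "d_t T w x t = of_real (d_t T q x t) + k * of_real (d_t T u x t)"
    by (rule d_t_linear_combination(1)[OF lin _ t])
      (simp_all add: w_def smooth_strip_differentiable(2) u q t)
  have "d_t T w x t + of_real (V x t) * d_x w x t
      = of_real (d_t T q x t + V x t * d_x q x t) + k * of_real (d_t T u x t + V x t * d_x u x t)"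
    by (simp add: wx wt algebra_simps)
  also have "\<dots> = of_real ((q x t)\<^sup>2) + k\<^sup>2 * of_real ((u x t)\<^sup>2) + k * of_real (2 * q x t * u x t)
      + of_real \<nu> * d_x (d_x w) x t"
    unfolding equ eqq k wxx by (simp add: algebra_simps)
  also have "\<dots> = (w x t)\<^sup>2 + of_real \<nu> * d_x (d_x w) x t"
    by (simp add: w_def power2_eq_square algebra_simps)
  finally show ?thesis .
qed

theorem theorem3p1:
  fixes \<nu> \<sigma> :: real and T :: ereal and u q V :: "real \<Rightarrow> real \<Rightarrow> real"
  assumes "\<nu> \<ge> 0" and "T > 0"
    and "smooth_strip T u" and "smooth_strip T q" and "smooth_strip T V"
    and "\<And>x t. t \<in> time_dom T \<Longrightarrow>
      d_t T u x t + V x t * d_x u x t = 2 * q x t * u x t + \<nu> * d_x (d_x u) x t"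
    and "\<And>x t. t \<in> time_dom T \<Longrightarrow>
      d_t T q x t + V x t * d_x q x t = (q x t)\<^sup>2 - \<sigma> * (u x t)\<^sup>2 + \<nu> * d_x (d_x q) x t"
    and "\<And>x t. t \<in> time_dom T \<Longrightarrow> d_x V x t = 2 * q x t"
    and "\<And>t. t \<in> time_dom T \<Longrightarrow> V 0 t = 0"
  shows "(\<forall>c::real. \<sigma> = c\<^sup>2 \<and> \<sigma> > 0 \<longrightarrow>
      (let Z = (\<lambda>x t. complex_of_real (q x t) + \<i> * complex_of_real c * complex_of_real (u x t))
       in smooth_strip T Z \<and>
          (\<forall>x. \<forall>t\<in>time_dom T.
             d_t T Z x t + complex_of_real (V x t) * d_x Z x t
               = (Z x t)\<^sup>2 + complex_of_real \<nu> * d_x (d_x Z) x t \<and>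
             d_x V x t = 2 * Re (Z x t))))
    \<and> (\<forall>c::real. \<sigma> = - c\<^sup>2 \<and> \<sigma> < 0 \<longrightarrow>
      (let ap = (\<lambda>x t. q x t + c * u x t); am = (\<lambda>x t. q x t - c * u x t)
       in smooth_strip T ap \<and> smooth_strip T am \<and>
          (\<forall>x. \<forall>t\<in>time_dom T.
             d_t T ap x t + V x t * d_x ap x t = (ap x t)\<^sup>2 + \<nu> * d_x (d_x ap) x t \<and>
             d_t T am x t + V x t * d_x am x t = (am x t)\<^sup>2 + \<nu> * d_x (d_x am) x t \<and>
             d_x V x t = ap x t + am x t)))"
proof -
  note u = assms(3) and q = assms(4)
  note square = reaction_square[where V = V, OF u q _ assms(6,7)]
  note smooth = smooth_strip_of_real_add_mult[OF q u]
  let ?Z = "\<lambda>c x t. complex_of_real (q x t) + \<i> * complex_of_real c * complex_of_real (u x t)"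
  show ?thesis
    unfolding Let_def
  proof (intro conjI allI impI ballI; (elim conjE)?)
    fix c x t
    assume \<sigma>: "\<sigma> = c\<^sup>2" and t: "t \<in> time_dom T"
    have "(\<i> * complex_of_real c)\<^sup>2 = - of_real \<sigma>" by (simp add: \<sigma> power_mult_distrib)
    from square[OF t t t this]
    show "d_t T (?Z c) x t + complex_of_real (V x t) * d_x (?Z c) x t
      = (?Z c x t)\<^sup>2 + complex_of_real \<nu> * d_x (d_x (?Z c)) x t" .
  next
    fix c x t
    assume \<sigma>: "\<sigma> = - c\<^sup>2" and t: "t \<in> time_dom T"
    show "d_t T (\<lambda>x t. q x t + c * u x t) x t + V x t * d_x (\<lambda>x t. q x t + c * u x t) x t
      = (q x t + c * u x t)\<^sup>2 + \<nu> * d_x (d_x (\<lambda>x t. q x t + c * u x t)) x t"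
      using square[OF t t t, of c] by (simp add: \<sigma>)
    show "d_t T (\<lambda>x t. q x t - c * u x t) x t + V x t * d_x (\<lambda>x t. q x t - c * u x t) x t
      = (q x t - c * u x t)\<^sup>2 + \<nu> * d_x (d_x (\<lambda>x t. q x t - c * u x t)) x t"
      using square[OF t t t, of "- c"] by (simp add: \<sigma>)
  next
    fix c
    show "smooth_strip T (\<lambda>x t. q x t + c * u x t)" using smooth[of c] by simp
    show "smooth_strip T (\<lambda>x t. q x t - c * u x t)" using smooth[of "- c"] by simp
  qed (simp_all add: smooth assms(8))
qed

end
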